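(* Let $f,g,h,t\geq 1$ be integers. Let $G$ be a $(K_{2,2},K_t)$-free graph and let $Z\subseteq V(G)$ with $|Z|\leq h$. Let $Z_0=\{z_1,z_2,z\}\subseteq Z$ be a $3$-clique such that the set of neighbors of $z$ in $Z$ is $\{z_1,z_2\}$. Let $\mathfrak{p}=(Z_0,\ldots,Z_f;\Gamma_i:i\in[f])$ be a $(Z_0,f+g+2^ht,f)$-phantom in $G$ such that $Z_f\cap Z=Z_0$. Then one of the following holds: (a) there exists a $(z_1,z_2,1,g)$-crystal $\mathfrak{c}$ in $G[Z_f]$ such that $V(\mathfrak{c})$ is anticomplete to $Z\setminus Z_0$; or (b) $G$ has a (not necessarily induced) subgraph isomorphic to $\operatorname{cone}(\operatorname{cone}(T_{f,f}))$.
   Context: Graphs are finite and simple; $G$ is $X$-free if no induced subgraph is isomorphic to $X$; sets of vertices are anticomplete if there are no edges between them; a $c$-clique is a clique of size $c$; $[n]=\{1,\ldots,n\}$. For $Z_0\subseteq V(G)$ and integers $d\geq1$, $r\geq0$, a $(Z_0,d,r)$-phantom in $G$ is a tuple $(Z_0,\ldots,Z_r;\Gamma_i:i\in[r])$ with $Z_0\subseteq\cdots\subseteq Z_r\subseteq V(G)$ such that for every $i\in[r]$, $\Gamma_i$ is a map with domain $E(G[Z_{i-1}])$, where for each edge $e$, $\Gamma_i(e)\subseteq Z_i\setminus Z_{i-1}$, $|\Gamma_i(e)|=d$, both ends of $e$ are complete to $\Gamma_i(e)$, and distinct edges have disjoint images. For adjacent $z_1,z_2$ and integers $f',g'\geq1$,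 a $(z_1,z_2,f',g')$-crystal in a graph $G'$ is a tuple $(S_{1,w},w,S_{2,w}:w\in S)$ with $S$ an $f'$-subset of $V(G')\setminus\{z_1,z_2\}$, the sets $S_{1,w},S_{2,w}$ ($w\in S$) pairwise disjoint $g'$-subsets of $V(G')\setminus(S\cup\{z_1,z_2\})$, and for each $i\in\{1,2\}$, $w\in S$, $x\in S_{i,w}$, the neighbors of $x$ in $\{z_1,z_2,w\}$ are exactly $\{z_i,w\}$; its vertex set is $V(\mathfrak{c})=S\cup\bigcup_{w\in S}(S_{1,w}\cup S_{2,w})$. $T_{d,r}$ is the rooted tree of radius $r$ whose root has degree $d$ (if $r\geq1$) and whose other non-leaf vertices have degree $d+1$. $\operatorname{cone}(F)$ is $F$ plus a new vertex adjacent to all of $F$. *)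

theory Defs
  imports Main "HOL-Library.Disjoint_Sets"
begin

record 'a ugraph =
  verts :: "'a set"
  edges :: "'a set set"

definition fin_simple_graph :: "'a ugraph \<Rightarrow> bool" where
  "fin_simple_graph G \<longleftrightarrow>
     finite (verts G) \<and> (\<forall>e\<in>edges G. e \<subseteq> verts G \<and> card e = 2)"

definition adj :: "'a ugraph \<Rightarrow> 'a \<Rightarrow> 'a \<Rightarrow> bool" where
  "adj G u v \<longleftrightarrow> {u, v} \<in> edges G"

definition nbrs :: "'a ugraph \<Rightarrow> 'a \<Rightarrow> 'a set" where
  "nbrs G v = {u. adj G v u}"

definition induced :: "'a ugraph \<Rightarrow> 'a set \<Rightarrow> 'a ugraph" where
  "induced G S = \<lparr>verts = verts G \<inter> S, edges = {e \<in> edges G. e \<subseteq> S}\<rparr>"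

definition subgraph :: "'a ugraph \<Rightarrow> 'a ugraph \<Rightarrow> bool" where
  "subgraph H G \<longleftrightarrow>
     fin_simple_graph H \<and> verts H \<subseteq> verts G \<and> edges H \<subseteq> edges G"

definition isomorphic :: "'a ugraph \<Rightarrow> 'b ugraph \<Rightarrow> bool" where
  "isomorphic G H \<longleftrightarrow>
     (\<exists>\<phi>. bij_betw \<phi> (verts G) (verts H) \<and>
          (\<forall>u\<in>verts G. \<forall>v\<in>verts G. adj G u v \<longleftrightarrow> adj H (\<phi> u) (\<phi> v)))"

definition graph_free :: "'a ugraph \<Rightarrow> 'b ugraph \<Rightarrow> bool" where
  "graph_free G X \<longleftrightarrow> \<not> (\<exists>S\<subseteq>verts G. isomorphic (induced G S) X)"

definition has_subgraph_iso :: "'a ugraph \<Rightarrow> 'b ugraph \<Rightarrow> bool" where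
  "has_subgraph_iso G X \<longleftrightarrow> (\<exists>H. subgraph H G \<and> isomorphic H X)"

definition anticomplete :: "'a ugraph \<Rightarrow> 'a set \<Rightarrow> 'a set \<Rightarrow> bool" where
  "anticomplete G A B \<longleftrightarrow> (\<forall>a\<in>A. \<forall>b\<in>B. \<not> adj G a b)"

definition is_clique :: "'a ugraph \<Rightarrow> nat \<Rightarrow> 'a set \<Rightarrow> bool" where
  "is_clique G c K \<longleftrightarrow>
     K \<subseteq> verts G \<and> card K = c \<and> (\<forall>u\<in>K. \<forall>v\<in>K. u \<noteq> v \<longrightarrow> adj G u v)"

definition complete_graph :: "nat \<Rightarrow> nat ugraph" where
  "complete_graph n = \<lparr>verts = {1..n}, edges = {e. e \<subseteq> {1..n} \<and> card e = 2}\<rparr>"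

definition complete_bipartite :: "nat \<Rightarrow> nat \<Rightarrow> (nat + nat) ugraph" where
  "complete_bipartite m n =
     \<lparr>verts = {1..m} <+> {1..n},
      edges = {{Inl i, Inr j} | i j. i \<in> {1..m} \<and> j \<in> {1..n}}\<rparr>"

text \<open>
  The tree \<open>T\<^sub>d\<^sub>,\<^sub>r\<close>: a vertex is a word of length at most \<open>r\<close> over \<open>{1..d}\<close>,
  the root is the empty word, and the parent of \<open>i # xs\<close> is \<open>xs\<close>. All leaves
  are at distance exactly \<open>r\<close> from the root.
\<close>

definition regular_tree :: "nat \<Rightarrow> nat \<Rightarrow> nat list ugraph" where
  "regular_tree d r =
     \<lparr>verts = {xs. set xs \<subseteq> {1..d} \<and> length xs \<le> r},
      edges = {{xs, i # xs} | xs i. set xs \<subseteq> {1..d} \<and> i \<in> {1..d} \<and> length xs < r}\<rparr>"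

text \<open>The new vertex is \<open>None\<close>.\<close>

definition cone :: "'a ugraph \<Rightarrow> 'a option ugraph" where
  "cone F =
     \<lparr>verts = insert None (Some ` verts F),
      edges = (\<lambda>e. Some ` e) ` edges F \<union> {{None, Some v} | v. v \<in> verts F}\<rparr>"

text \<open>
  \<open>Z i\<close> is relevant for \<open>i \<le> r\<close> only, and \<open>\<Gamma> i\<close> only for \<open>i \<in> {1..r}\<close>
  and on edges of the graph induced on \<open>Z (i - 1)\<close>; other values are arbitrary.
\<close>

definition phantom ::
  "'a ugraph \<Rightarrow> 'a set \<Rightarrow> nat \<Rightarrow> nat \<Rightarrow> (nat \<Rightarrow> 'a set) \<Rightarrow> (nat \<Rightarrow> 'a set \<Rightarrow> 'a set) \<Rightarrow> bool" where
  "phantom G Z0 d r Z \<Gamma> \<longleftrightarrow>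
     d \<ge> 1 \<and> Z 0 = Z0 \<and> (\<forall>i\<in>{1..r}. Z (i - 1) \<subseteq> Z i) \<and> Z r \<subseteq> verts G \<and>
     (\<forall>i\<in>{1..r}.
        (\<forall>e\<in>edges (induced G (Z (i - 1))).
           \<Gamma> i e \<subseteq> Z i - Z (i - 1) \<and> card (\<Gamma> i e) = d \<and>
           (\<forall>x\<in>e. \<forall>y\<in>\<Gamma> i e. adj G x y)) \<and>
        disjoint_family_on (\<Gamma> i) (edges (induced G (Z (i - 1)))))"

definition crystal ::
  "'a ugraph \<Rightarrow> 'a \<Rightarrow> 'a \<Rightarrow> nat \<Rightarrow> nat \<Rightarrow> 'a set \<Rightarrow> ('a \<Rightarrow> 'a set) \<Rightarrow> ('a \<Rightarrow> 'a set) \<Rightarrow> bool" where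
  "crystal G z1 z2 f g S S1 S2 \<longleftrightarrow>
     adj G z1 z2 \<and> f \<ge> 1 \<and> g \<ge> 1 \<and>
     S \<subseteq> verts G - {z1, z2} \<and> card S = f \<and>
     (\<forall>w\<in>S. S1 w \<subseteq> verts G - (S \<union> {z1, z2}) \<and> card (S1 w) = g \<and>
            S2 w \<subseteq> verts G - (S \<union> {z1, z2}) \<and> card (S2 w) = g) \<and>
     disjoint_family_on S1 S \<and> disjoint_family_on S2 S \<and>
     (\<forall>v\<in>S. \<forall>w\<in>S. S1 v \<inter> S2 w = {}) \<and>
     (\<forall>w\<in>S. \<forall>x\<in>S1 w. nbrs G x \<inter> {z1, z2, w} = {z1, w}) \<and>
     (\<forall>w\<in>S. \<forall>x\<in>S2 w. nbrs G x \<inter> {z1, z2, w} = {z2, w})"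

definition crystal_verts :: "'a set \<Rightarrow> ('a \<Rightarrow> 'a set) \<Rightarrow> ('a \<Rightarrow> 'a set) \<Rightarrow> 'a set" where
  "crystal_verts S S1 S2 = S \<union> (\<Union>w\<in>S. S1 w \<union> S2 w)"

lemma nbrs_regular_tree_root:
  "r \<ge> 1 \<Longrightarrow> nbrs (regular_tree d r) [] = (\<lambda>i. [i]) ` {1..d}"
  by (auto simp: nbrs_def adj_def regular_tree_def doubleton_eq_iff)

lemma nbrs_regular_tree_Cons:
  assumes "i # xs \<in> verts (regular_tree d r)"
  shows "nbrs (regular_tree d r) (i # xs) =
    insert xs (if length (i # xs) < r then (\<lambda>j. j # i # xs) ` {1..d} else {})"
proof -
  have "adj (regular_tree d r) (i # xs) ys \<longleftrightarrow>
      ys = xs \<or> (length (i # xs) < r \<and> (\<exists>j\<in>{1..d}. ys = j # i # xs))" for ys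
  proof -
    have "adj (regular_tree d r) (i # xs) ys \<longleftrightarrow>
        (\<exists>us j. {i # xs, ys} = {us, j # us} \<and> set us \<subseteq> {1..d} \<and> j \<in> {1..d} \<and> length us < r)"
      by (simp add: adj_def regular_tree_def)
    also have "\<dots> \<longleftrightarrow> ys = xs \<or> (length (i # xs) < r \<and> (\<exists>j\<in>{1..d}. ys = j # i # xs))"
      unfolding doubleton_eq_iff using assms by (fastforce simp: regular_tree_def)
    finally show ?thesis .
  qed
  then show ?thesis by (auto simp: nbrs_def)
qed

lemma fin_simple_graph_regular_tree: "fin_simple_graph (regular_tree d r)"
proof -
  have "finite {xs. set xs \<subseteq> {1..d} \<and> length xs \<le> r}"
    by (rule finite_lists_length_le) simp
  then show ?thesis
    by (auto simp: fin_simple_graph_def regular_tree_def card_insert_if)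
qed

lemma fin_simple_graph_cone: "fin_simple_graph F \<Longrightarrow> fin_simple_graph (cone F)"
  by (auto simp: fin_simple_graph_def cone_def card_image)

end

theory Submission
  imports Defs
begin

text \<open>
  Grow a copy of \<open>T\<^sub>f\<^sub>,\<^sub>f\<close> inside the common neighbourhood of \<open>z1\<close> and \<open>z2\<close>, starting
  from the root \<open>z\<close>, with level \<open>n\<close> in \<open>Zs n\<close> and all vertices anticomplete to \<open>Z - Z0\<close>.
  A vertex \<open>w\<close> of level \<open>n\<close> has no neighbour in \<open>Z - Z0\<close>, so its common neighbours with
  any vertex there form a clique, and at most \<open>h * t\<close> vertices of each of
  \<open>\<Gamma> (n + 1) {z1, w}\<close> and \<open>\<Gamma> (n + 1) {z2, w}\<close> see \<open>Z - Z0\<close>. Of the \<open>f + g\<close> others in each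
  set, either at least \<open>g\<close> miss the opposite \<open>z\<^sub>i\<close> in both sets, which gives a crystal at
  \<open>w\<close>, or one of the sets contains \<open>f\<close> common neighbours of \<open>z1\<close>, \<open>z2\<close>, \<open>w\<close>, which become
  the children of \<open>w\<close>.
\<close>

section \<open>Adjacency and copies of subgraphs\<close>

lemma adj_commute: "adj G u v \<longleftrightarrow> adj G v u"
  by (simp add: adj_def insert_commute)

lemma fin_simple_graph_adjD:
  assumes "fin_simple_graph G" "adj G u v"
  shows "u \<in> verts G" "v \<in> verts G" "u \<noteq> v"
proof -
  have *: "{u, v} \<subseteq> verts G" "card {u, v} = 2"
    using assms by (auto simp: fin_simple_graph_def adj_def)
  then show "u \<in> verts G" "v \<in> verts G" by auto
  show "u \<noteq> v" using *(2) by (auto simp: card_insert_if)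
qed

lemma adj_induced: "adj (induced G S) u v \<longleftrightarrow> adj G u v \<and> u \<in> S \<and> v \<in> S"
  by (auto simp: adj_def induced_def)

lemma finite_nbrs: "fin_simple_graph G \<Longrightarrow> finite (nbrs G v)"
  by (rule finite_subset[of _ "verts G"])
    (auto simp: nbrs_def dest: fin_simple_graph_adjD(2), auto simp: fin_simple_graph_def)

text \<open>The witness consists of exactly the images of the vertices and edges of
  \<open>X\<close>, so \<open>\<psi>\<close> is an isomorphism onto it even if \<open>G\<close> has
  further edges among these vertices.\<close>

lemma has_subgraph_isoI:
  assumes G: "fin_simple_graph G" and X: "fin_simple_graph X"
    and inj: "inj_on \<psi> (verts X)"
    and vs: "\<psi> ` verts X \<subseteq> verts G"
    and es: "(\<lambda>e. \<psi> ` e) ` edges X \<subseteq> edges G"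
  shows "has_subgraph_iso G X"
proof -
  define H where "H = \<lparr>verts = \<psi> ` verts X, edges = (\<lambda>e. \<psi> ` e) ` edges X\<rparr>"
  have sub: "e \<subseteq> verts X" if "e \<in> edges X" for e
    using X that by (auto simp: fin_simple_graph_def)
  have "subgraph H G"
    using G X vs es inj_on_subset[OF inj sub] image_mono[OF sub, of _ \<psi>]
    by (simp add: subgraph_def fin_simple_graph_def H_def card_image)
  moreover have "isomorphic H X"
    unfolding isomorphic_def
  proof (intro exI conjI ballI)
    \<comment> \<open>\<open>isomorphic H X\<close> asks for a map from \<open>H\<close> to
      \<open>X\<close>, hence the inverse of \<open>\<psi>\<close>.\<close>
    show "bij_betw (the_inv_into (verts X) \<psi>) (verts H) (verts X)"
      unfolding H_def using bij_betw_the_inv_into[OF inj_on_imp_bij_betw[OF inj]] by simp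
    fix u v assume "u \<in> verts H" "v \<in> verts H"
    then obtain a b where ab: "a \<in> verts X" "b \<in> verts X" "u = \<psi> a" "v = \<psi> b"
      by (auto simp: H_def)
    have "adj H u v \<longleftrightarrow> (\<exists>e\<in>edges X. \<psi> ` e = \<psi> ` {a, b})"
      by (auto simp: adj_def H_def ab)
    also have "\<dots> \<longleftrightarrow> adj X a b"
      using inj_on_image_eq_iff[OF inj sub, of _ "{a, b}"] ab
      by (auto simp: adj_def)
    finally show "adj H u v \<longleftrightarrow>
        adj X (the_inv_into (verts X) \<psi> u) (the_inv_into (verts X) \<psi> v)"
      using ab inj by (simp add: the_inv_into_f_f)
  qed
  ultimately show ?thesis by (auto simp: has_subgraph_iso_def)
qed

section \<open>Common neighbourhoods in graphs without induced \<open>K_{2,2}\<close> and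
  \<open>K_t\<close>\<close>

lemma card_clique_less_if_complete_graph_free:
  assumes G: "fin_simple_graph G" and free: "graph_free G (complete_graph t)"
    and K: "K \<subseteq> verts G" "\<And>u v. u \<in> K \<Longrightarrow> v \<in> K \<Longrightarrow> u \<noteq> v \<Longrightarrow> adj G u v"
  shows "card K < t"
proof (rule ccontr)
  assume "\<not> card K < t"
  \<comment> \<open>Any \<open>t\<close> vertices of \<open>K\<close> induce a copy of
    \<open>complete_graph t\<close>.\<close>
  then obtain S where S: "S \<subseteq> K" "card S = t"
    by (meson not_less obtain_subset_with_card_n)
  have "finite S"
    using G K(1) S(1) by (meson fin_simple_graph_def finite_subset)
  then obtain \<phi> where \<phi>: "bij_betw \<phi> S {1..t}"
    using S(2) by (metis card_atLeastAtMost diff_Suc_1 finite_atLeastAtMost finite_same_card_bij)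
  have "isomorphic (induced G S) (complete_graph t)"
    unfolding isomorphic_def
  proof (intro exI conjI ballI)
    have S': "verts (induced G S) = S"
      using S K by (auto simp: induced_def)
    show "bij_betw \<phi> (verts (induced G S)) (verts (complete_graph t))"
      using \<phi> S' by (simp add: complete_graph_def)
    fix u v assume "u \<in> verts (induced G S)" "v \<in> verts (induced G S)"
    then have uv: "u \<in> S" "v \<in> S" using S' by auto
    have "adj (induced G S) u v \<longleftrightarrow> u \<noteq> v"
      using uv S(1) K(2)[of u v] fin_simple_graph_adjD(3)[OF G, of u v] by (auto simp: adj_induced)
    also have "\<dots> \<longleftrightarrow> \<phi> u \<noteq> \<phi> v"
      using uv \<phi> by (metis bij_betw_inv_into_left)
    also have "\<dots> \<longleftrightarrow> adj (complete_graph t) (\<phi> u) (\<phi> v)"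
      using uv bij_betwE[OF \<phi>] by (auto simp: complete_graph_def adj_def card_insert_if)
    finally show "adj (induced G S) u v \<longleftrightarrow> adj (complete_graph t) (\<phi> u) (\<phi> v)" .
  qed
  then show False
    using free S K by (auto simp: graph_free_def)
qed

text \<open>Otherwise \<open>u\<close>, \<open>x\<close>, \<open>v\<close>, \<open>y\<close> would
  induce a 4-cycle, that is, \<open>K_{2,2}\<close> with sides \<open>{u, v}\<close> and
  \<open>{x, y}\<close>.\<close>

lemma adj_common_nbrs_if_K22_free:
  assumes G: "fin_simple_graph G" and free: "graph_free G (complete_bipartite 2 2)"
    and uv: "u \<noteq> v" "\<not> adj G u v"
    and xy: "x \<in> nbrs G u \<inter> nbrs G v" "y \<in> nbrs G u \<inter> nbrs G v" "x \<noteq> y"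
  shows "adj G x y"
proof (rule ccontr)
  assume nxy: "\<not> adj G x y"
  have a: "adj G u x" "adj G u y" "adj G v x" "adj G v y"
    using xy by (auto simp: nbrs_def)
  \<comment> \<open>The isomorphism is checked on all ordered pairs of the four vertices, which
    calls for both orientations and for the absence of loops.\<close>
  note a' = a[THEN adj_commute[THEN iffD1]]
  have irr: "\<not> adj G b b" for b
    using fin_simple_graph_adjD(3)[OF G] by blast
  have ne: "u \<noteq> x" "u \<noteq> y" "v \<noteq> x" "v \<noteq> y"
    using a fin_simple_graph_adjD(3)[OF G] by auto
  have vs: "{u, v, x, y} \<subseteq> verts G"
    using a fin_simple_graph_adjD[OF G] by blast
  define \<phi> :: "'a \<Rightarrow> nat + nat" where
    "\<phi> b = (if b = u then Inl 1 else if b = v then Inl 2 else if b = x then Inr 1 else Inr 2)" for b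
  have \<phi>: "\<phi> u = Inl 1" "\<phi> v = Inl 2" "\<phi> x = Inr 1" "\<phi> y = Inr 2"
    using ne uv xy(3) by (auto simp: \<phi>_def)
  have V: "verts (induced G {u, v, x, y}) = {u, v, x, y}"
    using vs by (auto simp: induced_def)
  have I12: "{1..2} = {1, 2::nat}" by auto
  have "isomorphic (induced G {u, v, x, y}) (complete_bipartite 2 2)"
    unfolding isomorphic_def V
  proof (intro exI conjI)
    show "bij_betw \<phi> {u, v, x, y} (verts (complete_bipartite 2 2))"
      by (auto simp: bij_betw_def inj_on_def \<phi> complete_bipartite_def I12 simp del: One_nat_def)
    show "\<forall>b\<in>{u, v, x, y}. \<forall>c\<in>{u, v, x, y}.
        adj (induced G {u, v, x, y}) b c \<longleftrightarrow> adj (complete_bipartite 2 2) (\<phi> b) (\<phi> c)"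
      using a a' irr uv(2) nxy adj_commute[of G u v] adj_commute[of G x y]
      unfolding adj_induced
      by (simp add: \<phi>) (auto simp: adj_def complete_bipartite_def doubleton_eq_iff)
  qed
  then show False
    using free vs by (auto simp: graph_free_def)
qed

lemma card_common_nbrs_less:
  assumes "fin_simple_graph G" "graph_free G (complete_bipartite 2 2)"
    "graph_free G (complete_graph t)" "u \<noteq> v" "\<not> adj G u v"
  shows "card (nbrs G u \<inter> nbrs G v) < t"
proof (rule card_clique_less_if_complete_graph_free)
  show "nbrs G u \<inter> nbrs G v \<subseteq> verts G"
    using fin_simple_graph_adjD[OF assms(1)] by (auto simp: nbrs_def)
  show "adj G x y" if "x \<in> nbrs G u \<inter> nbrs G v" "y \<in> nbrs G u \<inter> nbrs G v" "x \<noteq> y" for x y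
    by (rule adj_common_nbrs_if_K22_free[OF assms(1,2,4,5) that])
qed (fact assms)+

text \<open>Union bound: such a vertex is a common neighbour of \<open>w\<close> and some
  \<open>y\<close> in \<open>Y\<close>, and each of these non-adjacent pairs has fewer than
  \<open>t\<close> common neighbours.\<close>

lemma card_nbrs_with_nbr_in_le:
  assumes G: "fin_simple_graph G" "graph_free G (complete_bipartite 2 2)"
    "graph_free G (complete_graph t)"
    and Y: "finite Y" "w \<notin> Y" "\<And>y. y \<in> Y \<Longrightarrow> \<not> adj G w y"
  shows "card {x \<in> nbrs G w. \<exists>y\<in>Y. adj G x y} \<le> card Y * t"
proof -
  have "{x \<in> nbrs G w. \<exists>y\<in>Y. adj G x y} = (\<Union>y\<in>Y. nbrs G w \<inter> nbrs G y)"
    by (auto simp: nbrs_def adj_commute)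
  also have "card \<dots> \<le> (\<Sum>y\<in>Y. card (nbrs G w \<inter> nbrs G y))"
    using Y(1) by (rule card_UN_le)
  also have "\<dots> \<le> (\<Sum>y\<in>Y. t)"
    using card_common_nbrs_less[OF G] Y by (intro sum_mono) (metis less_imp_le)
  finally show ?thesis by simp
qed

section \<open>Embedding regular trees and their double cones\<close>

text \<open>\<open>P n w\<close> says that \<open>w\<close> may be used at level \<open>n\<close>,
  and \<open>X n w\<close> supplies its children. Both depend only on the level and the vertex, not
  on the tree grown so far, so all choices can be fixed in advance. Collisions are excluded by
  \<open>disj\<close> within a level and by \<open>fresh\<close> between levels.\<close>

lemma regular_tree_embedding:
  fixes P :: "nat \<Rightarrow> 'a \<Rightarrow> bool" and X :: "nat \<Rightarrow> 'a \<Rightarrow> 'a set"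
  assumes root: "P 0 a"
    and X: "\<And>n w. n < r \<Longrightarrow> P n w \<Longrightarrow> finite (X n w) \<and> card (X n w) = d"
    and step: "\<And>n w x. n < r \<Longrightarrow> P n w \<Longrightarrow> x \<in> X n w \<Longrightarrow> P (Suc n) x \<and> adj G w x"
    and disj: "\<And>n w w'. n < r \<Longrightarrow> P n w \<Longrightarrow> P n w' \<Longrightarrow> w \<noteq> w' \<Longrightarrow> X n w \<inter> X n w' = {}"
    and fresh: "\<And>m n w x. n < r \<Longrightarrow> m \<le> n \<Longrightarrow> P n w \<Longrightarrow> P m x \<Longrightarrow> x \<notin> X n w"
  obtains \<phi> where "inj_on \<phi> (verts (regular_tree d r))"
    and "\<And>xs. xs \<in> verts (regular_tree d r) \<Longrightarrow> P (length xs) (\<phi> xs)"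
    and "\<And>xs ys. adj (regular_tree d r) xs ys \<Longrightarrow> adj G (\<phi> xs) (\<phi> ys)"
proof -
  have "\<exists>c. n < r \<longrightarrow> P n w \<longrightarrow> bij_betw c {1..d} (X n w)" for n w
    using X[of n w] by (metis card_atLeastAtMost diff_Suc_1 finite_atLeastAtMost finite_same_card_bij)
  then obtain c where c: "\<And>n w. n < r \<Longrightarrow> P n w \<Longrightarrow> bij_betw (c n w) {1..d} (X n w)"
    by metis
  \<comment> \<open>Since the parent of \<open>i # xs\<close> is \<open>xs\<close>, recursion on the
    word descends from the root; \<open>c n w i\<close> is the child of \<open>w\<close> with label
    \<open>i\<close>.\<close>
  define \<phi> where "\<phi> = rec_list a (\<lambda>i xs w. c (length xs) w i)"
  have \<phi>_simps: "\<phi> [] = a" "\<phi> (i # xs) = c (length xs) (\<phi> xs) i" for i xs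
    by (simp_all add: \<phi>_def)
  let ?V = "verts (regular_tree d r)"
  have V_Cons: "i # xs \<in> ?V \<longleftrightarrow> i \<in> {1..d} \<and> length xs < r \<and> xs \<in> ?V" for i xs
    by (auto simp: regular_tree_def)
  have child: "\<phi> (i # xs) \<in> X (length xs) (\<phi> xs)"
    if "i \<in> {1..d}" "length xs < r" "P (length xs) (\<phi> xs)" for i xs
    using bij_betwE[OF c] that by (auto simp: \<phi>_simps)
  have P: "P (length xs) (\<phi> xs)" if "xs \<in> ?V" for xs
    using that by (induction xs) (use root child step V_Cons in \<open>auto simp: \<phi>_simps(1)\<close>)
  \<comment> \<open>If \<open>ys\<close> were longer, its parent would be at level
    \<open>length xs\<close> or deeper, and \<open>fresh\<close> would keep \<open>\<phi> xs\<close>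
    out of that parent's children. Used in both directions, this shows that equal images have equal
    levels.\<close>
  have len: "length xs \<ge> length ys" if "xs \<in> ?V" "ys \<in> ?V" "\<phi> xs = \<phi> ys" for xs ys
  proof (rule ccontr)
    assume less: "\<not> length xs \<ge> length ys"
    then obtain j ys' where ys: "ys = j # ys'" by (cases ys) auto
    then have "j \<in> {1..d}" "length ys' < r" "ys' \<in> ?V" using that(2) V_Cons by auto
    then show False
      using child[of j ys'] fresh[of "length ys'" "length xs" "\<phi> ys'" "\<phi> xs"] P[OF that(1)] P[of ys'] that(3) less ys
      by (simp add: not_le less_Suc_eq_le)
  qed
  have inj: "xs = ys" if "xs \<in> ?V" "ys \<in> ?V" "\<phi> xs = \<phi> ys" for xs ys
    using that
  proof (induction xs arbitrary: ys)
    case Nil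
    then show ?case using len[of "[]" ys] by simp
  next
    case (Cons i xs)
    have l: "length ys = length (i # xs)"
      using len[of "i # xs" ys] len[of ys "i # xs"] Cons.prems by simp
    then obtain j ys' where ys: "ys = j # ys'" by (cases ys) auto
    have i: "i \<in> {1..d}" "length xs < r" "xs \<in> ?V" and j: "j \<in> {1..d}" "ys' \<in> ?V"
      using Cons.prems ys V_Cons by auto
    have l': "length ys' = length xs" using l ys by simp
    \<comment> \<open>The common image lies in the child sets of both parents, so by
      \<open>disj\<close> these parents have the same image.\<close>
    have "\<phi> xs = \<phi> ys'"
      using child[of i xs] child[of j ys'] disj[of "length xs" "\<phi> xs" "\<phi> ys'"]
        P[of xs] P[of ys'] i j l' Cons.prems(3) ys by auto
    moreover from this have "i = j"
      using c[of "length xs" "\<phi> xs"] P[of xs] i j Cons.prems(3) ys l'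
      by (auto simp: \<phi>_simps bij_betw_def dest: inj_onD)
    ultimately show ?case using Cons.IH i(3) j(2) ys by simp
  qed
  have edge: "adj G (\<phi> xs) (\<phi> (i # xs))" if "i # xs \<in> ?V" for i xs
    using child[of i xs] step P[of xs] that V_Cons by blast
  have "adj G (\<phi> xs) (\<phi> ys)" if "adj (regular_tree d r) xs ys" for xs ys
  proof -
    have "\<exists>us i. {xs, ys} = {us, i # us} \<and> set us \<subseteq> {1..d} \<and> i \<in> {1..d} \<and> length us < r"
      using that by (simp add: adj_def regular_tree_def)
    then obtain us i where *: "{xs, ys} = {us, i # us}"
        "set us \<subseteq> {1..d}" "i \<in> {1..d}" "length us < r"
      by (elim exE conjE)
    then have "i # us \<in> ?V"
      by (simp add: regular_tree_def)
    with *(1) show ?thesis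
      using edge adj_commute by (metis doubleton_eq_iff)
  qed
  with inj P show thesis by (intro that) (auto intro: inj_onI)
qed

text \<open>The outer apex goes to \<open>u\<close> and the inner one to \<open>v\<close>; the two
  apices are adjacent in the double cone, hence the hypothesis on \<open>u\<close> and
  \<open>v\<close>. As \<open>G\<close> has no loops, \<open>apex\<close> also keeps the image of
  \<open>\<phi>\<close> away from \<open>u\<close> and \<open>v\<close>.\<close>

lemma has_subgraph_iso_cone_cone:
  assumes G: "fin_simple_graph G" and F: "fin_simple_graph F" and uv: "adj G u v"
    and inj: "inj_on \<phi> (verts F)"
    and apex: "\<And>x. x \<in> verts F \<Longrightarrow> adj G u (\<phi> x) \<and> adj G v (\<phi> x)"
    and edge: "\<And>x y. adj F x y \<Longrightarrow> adj G (\<phi> x) (\<phi> y)"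
  shows "has_subgraph_iso G (cone (cone F))"
proof -
  define \<psi> where "\<psi> = case_option u (case_option v \<phi>)"
  have \<psi>: "\<psi> None = u" "\<psi> (Some None) = v" "\<psi> (Some (Some x)) = \<phi> x" for x
    by (simp_all add: \<psi>_def)
  note D = fin_simple_graph_adjD[OF G]
  have apex_ne: "u \<noteq> \<phi> x" "v \<noteq> \<phi> x" if "x \<in> verts F" for x
    using apex[OF that] D(3) by blast+
  have V: "verts (cone (cone F)) = {None, Some None} \<union> (\<lambda>x. Some (Some x)) ` verts F"
    by (auto simp: cone_def)
  show ?thesis
  proof (rule has_subgraph_isoI[OF G])
    show "fin_simple_graph (cone (cone F))"
      by (intro fin_simple_graph_cone F)
    show "inj_on \<psi> (verts (cone (cone F)))"
      unfolding V using D(3)[OF uv] apex_ne inj by (auto simp: inj_on_def \<psi>)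
    show "\<psi> ` verts (cone (cone F)) \<subseteq> verts G"
      unfolding V using D(1,2)[OF uv] D(2)[of u] apex by (fastforce simp: \<psi>)
    have "(\<lambda>x. \<psi> (Some (Some x))) ` e \<in> edges G" if "e \<in> edges F" for e
    proof -
      have "card e = 2" using F that by (auto simp: fin_simple_graph_def)
      then obtain x y where "e = {x, y}" by (auto simp: card_2_iff)
      then show ?thesis using edge[of x y] that by (simp add: \<psi> adj_def)
    qed
    then show "(\<lambda>e. \<psi> ` e) ` edges (cone (cone F)) \<subseteq> edges G"
      using uv apex by (auto simp: cone_def \<psi> adj_def image_image)
  qed
qed

text \<open>Pigeonhole, applied below with \<open>m = f\<close> and \<open>n = g\<close> to decide
  between children for the tree and leaves for a crystal.\<close>

lemma card_ge_split:
  assumes "finite A" "card A \<ge> m + n"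
  shows "card {x \<in> A. P x} \<ge> m \<or> card {x \<in> A. \<not> P x} \<ge> n"
proof -
  have "A = {x \<in> A. P x} \<union> {x \<in> A. \<not> P x}" by auto
  then have "card A \<le> card {x \<in> A. P x} + card {x \<in> A. \<not> P x}"
    by (metis card_Un_le)
  then show ?thesis using assms by linarith
qed

section \<open>Growing the tree through the levels of the phantom\<close>

lemma phantom_mono:
  assumes "phantom G Z0 d r Zs \<Gamma>" "m \<le> n" "n \<le> r"
  shows "Zs m \<subseteq> Zs n"
  using assms(2,3)
proof (induction n rule: dec_induct)
  case (step n)
  then have "Zs (Suc n - 1) \<subseteq> Zs (Suc n)"
    using assms(1) unfolding phantom_def by (metis One_nat_def Suc_le_mono atLeastAtMost_iff zero_le)
  with step show ?case by auto
qed simp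

theorem theorem3p2:
  fixes f g h t :: nat
    and G :: "'a ugraph"
    and Z :: "'a set"
    and z1 z2 z :: 'a
    and Zs :: "nat \<Rightarrow> 'a set"
    and \<Gamma> :: "nat \<Rightarrow> 'a set \<Rightarrow> 'a set"
  assumes "f \<ge> 1" and "g \<ge> 1" and "h \<ge> 1" and "t \<ge> 1"
    and "fin_simple_graph G"
    and "graph_free G (complete_bipartite 2 2)"
    and "graph_free G (complete_graph t)"
    and "Z \<subseteq> verts G" and "card Z \<le> h"
    and "{z1, z2, z} \<subseteq> Z"
    and "is_clique G 3 {z1, z2, z}"
    and "nbrs G z \<inter> Z = {z1, z2}"
    and "phantom G {z1, z2, z} (f + g + 2 ^ h * t) f Zs \<Gamma>"
    and "Zs f \<inter> Z = {z1, z2, z}"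
  shows "(\<exists>S S1 S2. crystal (induced G (Zs f)) z1 z2 1 g S S1 S2 \<and>
             anticomplete G (crystal_verts S S1 S2) (Z - {z1, z2, z}))
         \<or> has_subgraph_iso G (cone (cone (regular_tree f f)))"
proof -
  note G = assms(5)
  note D = fin_simple_graph_adjD[OF G]
  note ph = assms(13)
  note mono = phantom_mono[OF ph]
  define Y where "Y = Z - {z1, z2, z}"
  \<comment> \<open>The invariant of tree vertices. Adjacency to \<open>z1\<close> and
    \<open>z2\<close> makes \<open>{z1, w}\<close> and \<open>{z2, w}\<close> edges inside
    \<open>Zs n\<close>, so that \<open>\<Gamma> (Suc n)\<close> offers the candidates
    \<open>E n w\<close> for the next level.\<close>
  define P where "P n w \<longleftrightarrow> w \<in> Zs n \<and> adj G z1 w \<and> adj G z2 w \<and> (\<forall>y\<in>Y. \<not> adj G w y)" for n w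
  define E where "E n w = \<Gamma> (Suc n) {z1, w} \<union> \<Gamma> (Suc n) {z2, w}" for n w
  define crys where "crys \<longleftrightarrow> (\<exists>S S1 S2. crystal (induced G (Zs f)) z1 z2 1 g S S1 S2 \<and>
             anticomplete G (crystal_verts S S1 S2) (Z - {z1, z2, z}))"
  have finZ: "finite Z" using assms(8) G by (meson fin_simple_graph_def finite_subset)
  then have finY: "finite Y" by (simp add: Y_def)
  have "card Y \<le> card Z" unfolding Y_def using finZ by (intro card_mono) auto
  \<comment> \<open>The bound \<open>h\<close> is relaxed to \<open>2 ^ h\<close> to match the
    surplus \<open>2 ^ h * t\<close> in the phantom's parameter.\<close>
  also have "\<dots> \<le> 2 ^ h" using assms(9) less_exp[of h] by linarith
  finally have cardY: "card Y * t \<le> 2 ^ h * t" by simp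
  have "card {z1, z2, z} = 3" and cl: "\<And>u v. u \<in> {z1, z2, z} \<Longrightarrow> v \<in> {z1, z2, z} \<Longrightarrow> u \<noteq> v \<Longrightarrow> adj G u v"
    using assms(11) by (auto simp: is_clique_def)
  then have ne: "z1 \<noteq> z2" "z1 \<noteq> z" "z2 \<noteq> z" by (auto simp: card_insert_if split: if_splits)
  then have zz: "adj G z1 z2" "adj G z1 z" "adj G z2 z" using cl by auto
  have Zs0: "Zs 0 = {z1, z2, z}" using ph by (simp add: phantom_def)
  have z12: "z1 \<in> Zs n" "z2 \<in> Zs n" if "n \<le> f" for n
    using mono[of 0 n] Zs0 that by auto
  have Y_Zs: "w \<notin> Y" if "w \<in> Zs n" "n \<le> f" for w n
    using mono[of n f] that assms(14) by (auto simp: Y_def)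
  have \<Gamma>: "\<Gamma> (Suc n) {u, w} \<subseteq> Zs (Suc n) - Zs n" "card (\<Gamma> (Suc n) {u, w}) = f + g + 2 ^ h * t"
      "x \<in> \<Gamma> (Suc n) {u, w} \<Longrightarrow> adj G u x \<and> adj G w x"
    if "n < f" "adj G u w" "u \<in> Zs n" "w \<in> Zs n" for n u w x
  proof -
    have "Suc n \<in> {1..f}" "{u, w} \<in> edges (induced G (Zs (Suc n - 1)))"
      using that by (auto simp: induced_def adj_def)
    then show "\<Gamma> (Suc n) {u, w} \<subseteq> Zs (Suc n) - Zs n" "card (\<Gamma> (Suc n) {u, w}) = f + g + 2 ^ h * t"
      "x \<in> \<Gamma> (Suc n) {u, w} \<Longrightarrow> adj G u x \<and> adj G w x"
      using ph unfolding phantom_def by (fastforce)+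
  qed
  have \<Gamma>_disj: "\<Gamma> (Suc n) {u, w} \<inter> \<Gamma> (Suc n) {u', w'} = {}"
    if "n < f" "adj G u w" "u \<in> Zs n" "w \<in> Zs n" "adj G u' w'" "u' \<in> Zs n" "w' \<in> Zs n"
      "{u, w} \<noteq> {u', w'}" for n u w u' w'
  proof -
    have "Suc n \<in> {1..f}" "{u, w} \<in> edges (induced G (Zs n))" "{u', w'} \<in> edges (induced G (Zs n))"
      using that by (auto simp: induced_def adj_def)
    moreover have "disjoint_family_on (\<Gamma> (Suc n)) (edges (induced G (Zs (Suc n - 1))))"
      using ph calculation(1) unfolding phantom_def by blast
    ultimately show ?thesis using that(8) by (auto simp: disjoint_family_on_def)
  qed
  \<comment> \<open>Taking \<open>X\<close> inside \<open>E n w\<close> lets the phantom's axioms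
    give disjointness and freshness later.\<close>
  have ex: "\<exists>X. X \<subseteq> E n w \<and> finite X \<and> card X = f \<and> (\<forall>x\<in>X. P (Suc n) x \<and> adj G w x)"
    if n: "n < f" and w: "P n w" and nc: "\<not> crys" for n w
  proof -
    have wZ: "w \<in> Zs n" and adjw: "adj G z1 w" "adj G z2 w" and wY: "\<And>y. y \<in> Y \<Longrightarrow> \<not> adj G w y"
      using w by (auto simp: P_def)
    have zn: "z1 \<in> Zs n" "z2 \<in> Zs n" using z12 n by auto
    note wne = D(3)[OF adjw(1)] D(3)[OF adjw(2)]
    have wY': "w \<notin> Y" using Y_Zs wZ n by simp
    have \<Gamma>u: "\<Gamma> (Suc n) {u, w} \<subseteq> Zs (Suc n) - Zs n" "card (\<Gamma> (Suc n) {u, w}) = f + g + 2 ^ h * t"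
      "x \<in> \<Gamma> (Suc n) {u, w} \<Longrightarrow> adj G u x \<and> adj G w x" if "u = z1 \<or> u = z2" for u x
      using \<Gamma>[OF n, of u w] that adjw zn wZ by blast+
    \<comment> \<open>At most \<open>2 ^ h * t\<close> vertices of each image see \<open>Y\<close>,
      so at least \<open>g + f\<close> remain in \<open>A u\<close>.\<close>
    define A where "A u = {x \<in> \<Gamma> (Suc n) {u, w}. \<forall>y\<in>Y. \<not> adj G x y}" for u
    have A: "finite (A u) \<and> card (A u) \<ge> g + f" if u: "u = z1 \<or> u = z2" for u
    proof -
      have c: "card (\<Gamma> (Suc n) {u, w}) = f + g + 2 ^ h * t" and sub: "\<Gamma> (Suc n) {u, w} \<subseteq> nbrs G w"
        using \<Gamma>u[OF u] by (auto simp: nbrs_def)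
      have fin: "finite (\<Gamma> (Suc n) {u, w})"
        using sub finite_nbrs[OF G] finite_subset by blast
      have "card {x \<in> \<Gamma> (Suc n) {u, w}. \<not> (\<forall>y\<in>Y. \<not> adj G x y)}
          \<le> card {x \<in> nbrs G w. \<exists>y\<in>Y. adj G x y}"
        using sub finite_nbrs[OF G] by (intro card_mono) auto
      also have "\<dots> \<le> 2 ^ h * t"
        using card_nbrs_with_nbr_in_le[OF G assms(6,7) finY wY' wY] cardY by linarith
      finally have "\<not> card {x \<in> \<Gamma> (Suc n) {u, w}. \<not> (\<forall>y\<in>Y. \<not> adj G x y)} \<ge> 2 ^ h * t + 1" by simp
      moreover have "card (A u) + card {x \<in> \<Gamma> (Suc n) {u, w}. \<not> (\<forall>y\<in>Y. \<not> adj G x y)}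
        = card (\<Gamma> (Suc n) {u, w})"
        unfolding A_def using fin
        by (subst card_Un_disjoint[symmetric]) (auto intro!: arg_cong[where f = card])
      ultimately show ?thesis using c fin by (auto simp: A_def)
    qed
    have child: "\<exists>X. X \<subseteq> E n w \<and> finite X \<and> card X = f \<and> (\<forall>x\<in>X. P (Suc n) x \<and> adj G w x)"
      if u: "u = z1 \<or> u = z2" and c: "card {x \<in> A u. adj G z1 x \<and> adj G z2 x} \<ge> f" for u
    proof -
      obtain X where X: "X \<subseteq> {x \<in> A u. adj G z1 x \<and> adj G z2 x}" "card X = f" "finite X"
        using obtain_subset_with_card_n[OF c] by blast
      have "A u \<subseteq> E n w" using u by (auto simp: A_def E_def)
      moreover have "P (Suc n) x \<and> adj G w x" if "x \<in> X" for x
        using that X(1) \<Gamma>u(1,3)[OF u] by (auto simp: P_def A_def)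
      ultimately show ?thesis using X by (intro exI[of _ X]) auto
    qed
    show ?thesis
    proof (rule ccontr)
      assume no: "\<not> ?thesis"
      \<comment> \<open>All of \<open>A u\<close> is adjacent to \<open>u\<close>, so a vertex of
        \<open>C u\<close> misses the other one of \<open>z1\<close> and \<open>z2\<close>.\<close>
      define C where "C u = {x \<in> A u. \<not> (adj G z1 x \<and> adj G z2 x)}" for u
      have "\<exists>B. B \<subseteq> C u \<and> card B = g" if u: "u = z1 \<or> u = z2" for u
      proof -
        have "\<not> f \<le> card {x \<in> A u. adj G z1 x \<and> adj G z2 x}"
          using child[OF u] no by blast
        then have "g \<le> card (C u)"
          using card_ge_split[of "A u" f g "\<lambda>x. adj G z1 x \<and> adj G z2 x"] A[OF u]
          by (simp add: C_def add.commute)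
        then show ?thesis
          by (rule obtain_subset_with_card_n) blast
      qed
      then obtain B where B: "\<And>u. u = z1 \<or> u = z2 \<Longrightarrow>
          B u \<subseteq> C u \<and> card (B u) = g"
        by metis
      \<comment> \<open>Vertices of \<open>B u\<close> lie outside \<open>Zs n\<close>, which
        contains \<open>w\<close>, \<open>z1\<close> and \<open>z2\<close>; this keeps them apart
        from the rest of the crystal.\<close>
      have BZ: "B u \<subseteq> Zs f - Zs n" and Bw: "x \<in> B u \<Longrightarrow> adj G x w" "x \<in> B u \<Longrightarrow> adj G x u"
        and BY: "x \<in> B u \<Longrightarrow> y \<in> Y \<Longrightarrow> \<not> adj G x y" if u: "u = z1 \<or> u = z2" for u x y
        using B[OF u] \<Gamma>u(1,3)[OF u] mono[of "Suc n" f] n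
        unfolding A_def C_def adj_commute[of G x w] adj_commute[of G x u] by auto
      have B_not: "x \<in> B z1 \<Longrightarrow> \<not> adj G x z2" "x \<in> B z2 \<Longrightarrow> \<not> adj G x z1" for x
        using B[of z1] B[of z2] Bw(2)[of z1 x] Bw(2)[of z2 x]
        by (auto simp: C_def adj_commute[of G x])
      have disj: "B z1 \<inter> B z2 = {}"
        using Bw(2) B_not by blast
      have ZsG: "Zs f \<subseteq> verts G" using ph by (simp add: phantom_def)
      have inf: "w \<in> Zs f" "z1 \<in> Zs f" "z2 \<in> Zs f" using mono[of n f] n wZ zn by auto
      have V: "verts (induced G (Zs f)) = Zs f" using ZsG by (auto simp: induced_def)
      have S: "B u \<subseteq> Zs f - ({w} \<union> {z1, z2})" if u: "u = z1 \<or> u = z2" for u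
        using BZ[OF u] wZ zn by auto
      have N1: "nbrs (induced G (Zs f)) x \<inter> {z1, z2, w} = {z1, w}" if "x \<in> B z1" for x
        using that Bw[of z1 x] B_not(1)[of x] S[of z1] inf by (auto simp: nbrs_def adj_induced)
      have N2: "nbrs (induced G (Zs f)) x \<inter> {z1, z2, w} = {z2, w}" if "x \<in> B z2" for x
        using that Bw[of z2 x] B_not(2)[of x] S[of z2] inf by (auto simp: nbrs_def adj_induced)
      \<comment> \<open>The centre set is the singleton \<open>{w}\<close>, so constant functions
        serve as the two families.\<close>
      have "crystal (induced G (Zs f)) z1 z2 1 g {w} (\<lambda>_. B z1) (\<lambda>_. B z2)"
        unfolding crystal_def V
        using assms(2) zz(1) inf wne S[of z1] S[of z2] B[of z1] B[of z2] disj N1 N2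
        by (simp add: adj_induced disjoint_family_on_def)
      moreover have "anticomplete G (crystal_verts {w} (\<lambda>_. B z1) (\<lambda>_. B z2)) (Z - {z1, z2, z})"
        using wY BY[of z1] BY[of z2] by (auto simp: anticomplete_def crystal_verts_def Y_def)
      ultimately show False using nc unfolding crys_def by blast
    qed
  qed
  show ?thesis
  proof (cases crys)
    case True
    then show ?thesis by (simp add: crys_def)
  next
    case False
    have "\<exists>X. n < f \<longrightarrow> P n w \<longrightarrow> X \<subseteq> E n w \<and> finite X \<and> card X = f \<and> (\<forall>x\<in>X. P (Suc n) x \<and> adj G w x)"
      for n w using ex False by blast
    then obtain X where X: "\<And>n w. n < f \<Longrightarrow> P n w \<Longrightarrow>
        X n w \<subseteq> E n w \<and> finite (X n w) \<and> card (X n w) = f \<and> (\<forall>x\<in>X n w. P (Suc n) x \<and> adj G w x)"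
      by metis
    have PD: "w \<in> Zs n" "adj G z1 w" "adj G z2 w" if "P n w" for n w
      using that by (auto simp: P_def)
    have disj: "X n w \<inter> X n w' = {}" if "n < f" "P n w" "P n w'" "w \<noteq> w'" for n w w'
    proof -
      \<comment> \<open>Once \<open>w\<close> and \<open>w'\<close> avoid \<open>z1\<close> and
        \<open>z2\<close>, the edges from these two vertices to \<open>w\<close> differ from those
        to \<open>w'\<close>, and distinct edges have disjoint images.\<close>
      have "w \<noteq> z1" "w \<noteq> z2" "w' \<noteq> z1" "w' \<noteq> z2"
        using PD(2,3)[OF that(2)] PD(2,3)[OF that(3)] D(3) by blast+
      then have "\<Gamma> (Suc n) {u, w} \<inter> \<Gamma> (Suc n) {u', w'} = {}"
        if "u = z1 \<or> u = z2" "u' = z1 \<or> u' = z2" for u u'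
        using that \<open>n < f\<close> \<open>w \<noteq> w'\<close> PD[OF \<open>P n w\<close>] PD[OF \<open>P n w'\<close>] z12[of n]
        by (intro \<Gamma>_disj) (auto simp: doubleton_eq_iff)
      then have "E n w \<inter> E n w' = {}" unfolding E_def by blast
      then show ?thesis using X that by blast
    qed
    have fresh: "x \<notin> X n w" if "n < f" "m \<le> n" "P n w" "P m x" for m n w x
    proof -
      \<comment> \<open>Earlier levels lie in \<open>Zs n\<close>, whereas
        \<open>\<Gamma> (Suc n)\<close> takes its values outside \<open>Zs n\<close>.\<close>
      have "x \<in> Zs n" using mono[of m n] PD(1)[OF that(4)] that by auto
      moreover have "E n w \<inter> Zs n = {}"
        using \<Gamma>(1)[OF that(1) PD(2)[OF that(3)]] \<Gamma>(1)[OF that(1) PD(3)[OF that(3)]]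
          PD(1)[OF that(3)] z12[of n] that(1) by (auto simp: E_def)
      ultimately show ?thesis using X that by blast
    qed
    \<comment> \<open>The root is admissible because \<open>z\<close> has no neighbours in
      \<open>Z\<close> besides \<open>z1\<close> and \<open>z2\<close>.\<close>
    have "adj G z u \<Longrightarrow> u \<in> Z \<Longrightarrow> u \<in> {z1, z2}" for u
      using assms(12) by (auto simp: nbrs_def)
    then have P0: "P 0 z" using Zs0 zz by (auto simp: P_def Y_def)
    have X_card: "finite (X n w) \<and> card (X n w) = f" if "n < f" "P n w" for n w
      using X that by blast
    have X_step: "P (Suc n) x \<and> adj G w x" if "n < f" "P n w" "x \<in> X n w" for n w x
      using X that by blast
    obtain \<phi> where "inj_on \<phi> (verts (regular_tree f f))"
      and "\<And>xs. xs \<in> verts (regular_tree f f) \<Longrightarrow> P (length xs) (\<phi> xs)"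
      and "\<And>xs ys. adj (regular_tree f f) xs ys \<Longrightarrow> adj G (\<phi> xs) (\<phi> ys)"
      by (rule regular_tree_embedding[of P z f X f G]) ((rule P0 X_card X_step disj fresh; assumption)+, blast)
    \<comment> \<open>Every tree vertex satisfies \<open>P\<close> at its level, so the adjacent
      vertices \<open>z1\<close> and \<open>z2\<close> serve as the two apices.\<close>
    then have "has_subgraph_iso G (cone (cone (regular_tree f f)))"
      using PD(2,3) by (intro has_subgraph_iso_cone_cone[OF G fin_simple_graph_regular_tree zz(1)]) blast+
    then show ?thesis ..
  qed
qed

end
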